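(* Let $S\subset\mathbb{R}^2$ be a finite set of points, not all collinear, such that no four points of $S$ lie on a common circle or a common line. For a triangle $\Delta$ let $R_\Delta$ denote its circumradius. Let $DT(S)$ be the Delaunay triangulation of $S$. Then for every increasing function $\varphi:(0,\infty)\to\mathbb{R}$ and every triangulation $t$ of $S$, $$\sum_{\Delta\in DT(S)}\varphi(R_\Delta)\;\le\;\sum_{\Delta\in t}\varphi(R_\Delta).$$
   Context: A triangulation of a finite planar set $S$ is a finite collection of nondegenerate triangles whose union is the convex hull of $S$, any two of which intersect in a common (possibly empty) face, and whose set of vertices is exactly $S$; sums over $\Delta\in t$ run over the triangles of $t$. The Delaunay triangulation $DT(S)$ is the straight-line dual of the Voronoi diagram of $S$; equivalently, it consists of the nondegenerate triangles with vertices in $S$ whose open circumscribed disk contains no point of $S$. *)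

theory Defs
  imports "HOL-Analysis.Analysis"
begin

text \<open>
  A nondegenerate triangle is a solid \<open>2\<close>-simplex in the plane, that is, a set
  \<open>T\<close> with \<open>2 simplex T\<close>.
\<close>

definition vertices_of :: "(real^2) set \<Rightarrow> (real^2) set" where
  "vertices_of T = {x. x extreme_point_of T}"

definition circumcenter :: "(real^2) set \<Rightarrow> real^2" where
  "circumcenter T = (THE z. \<exists>r. \<forall>v\<in>vertices_of T. dist z v = r)"

definition circumradius :: "(real^2) set \<Rightarrow> real" where
  "circumradius T = (THE r. \<forall>v\<in>vertices_of T. dist (circumcenter T) v = r)"

text \<open>
  The library predicate \<^const>\<open>triangulation\<close> states finiteness and that any two
  members meet in a (possibly empty) common face, but it allows simplices of every
  dimension and does not mention the triangulated set.
\<close>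

definition triangulation_of :: "(real^2) set \<Rightarrow> (real^2) set set \<Rightarrow> bool" where
  "triangulation_of S t \<longleftrightarrow>
     triangulation t \<and> (\<forall>T\<in>t. 2 simplex T) \<and>
     \<Union>t = convex hull S \<and> (\<Union>T\<in>t. vertices_of T) = S"

definition delaunay :: "(real^2) set \<Rightarrow> (real^2) set set" where
  "delaunay S =
     {T. 2 simplex T \<and> vertices_of T \<subseteq> S \<and>
         ball (circumcenter T) (circumradius T) \<inter> S = {}}"

definition cocircular :: "(real^2) set \<Rightarrow> bool" where
  "cocircular Q \<longleftrightarrow> (\<exists>z r. r > 0 \<and> Q \<subseteq> sphere z r)"

definition general_position :: "(real^2) set \<Rightarrow> bool" where
  "general_position S \<longleftrightarrow> (\<forall>Q\<subseteq>S. card Q = 4 \<longrightarrow> \<not> cocircular Q \<and> \<not> collinear Q)"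


text \<open>The definite descriptions above are meaningful for nondegenerate triangles.\<close>

lemma simplex_2_obtain:
  fixes T :: "(real^2) set"
  assumes "2 simplex T"
  obtains a b c where "\<not> collinear {a,b,c}" "T = convex hull {a,b,c}" "vertices_of T = {a,b,c}"
proof -
  obtain C where C: "\<not> affine_dependent C" "int (card C) = 2 + 1" "T = convex hull C"
    using assms unfolding simplex_def by blast
  then have "card C = 3" by simp
  then obtain a b c where abc: "C = {a,b,c}" "a \<noteq> b" "b \<noteq> c" "a \<noteq> c"
    by (auto simp: card_3_iff)
  have "\<not> collinear {a,b,c}"
    using C abc by (simp add: collinear_3_eq_affine_dependent)
  moreover have "vertices_of T = {a,b,c}"
    using C abc by (auto simp: vertices_of_def extreme_point_of_convex_hull_affine_independent)
  ultimately show thesis using that C abc by blast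
qed

lemma noncollinear_det:
  fixes a b c :: "real^2"
  assumes "\<not> collinear {a,b,c}"
  shows "(b-a)$1 * (c-a)$2 - (b-a)$2 * (c-a)$1 \<noteq> 0"
proof
  define u v where "u = b - a" and "v = c - a"
  assume "(b-a)$1 * (c-a)$2 - (b-a)$2 * (c-a)$1 = 0"
  then have D: "u$1 * v$2 = u$2 * v$1" by (simp add: u_def v_def)
  have nc: "\<not> collinear {0, u, v}"
    using assms collinear_3[of b a c] by (auto simp: insert_commute u_def v_def)
  then have nz: "u \<noteq> 0" and no: "\<And>k. v \<noteq> k *\<^sub>R u"
    by (auto simp: collinear_lemma)
  show False
  proof (cases "u$1 = 0")
    case True
    then have "u$2 \<noteq> 0" using nz by (auto simp: vec_eq_iff forall_2)
    then have "v = (v$2 / u$2) *\<^sub>R u"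
      using D True by (auto simp: vec_eq_iff forall_2)
    then show False using no by blast
  next
    case False
    then have "v = (v$1 / u$1) *\<^sub>R u"
      using D by (auto simp: vec_eq_iff forall_2 field_simps)
    then show False using no by blast
  qed
qed

lemma dist_eq_iff_2:
  fixes z a b :: "real^2"
  shows "dist z a = dist z b \<longleftrightarrow>
    2 * ((z-a)$1 * (b-a)$1 + (z-a)$2 * (b-a)$2) = ((b-a)$1)\<^sup>2 + ((b-a)$2)\<^sup>2"
  unfolding dist_norm norm_eq
  by (simp add: inner_vec_def sum_2 power2_eq_square algebra_simps)

lemma circumcenter_ex1:
  fixes T :: "(real^2) set"
  assumes "2 simplex T"
  shows "\<exists>!z. \<exists>r. \<forall>v\<in>vertices_of T. dist z v = r"
proof -
  obtain a b c where nc: "\<not> collinear {a,b,c}" and V: "vertices_of T = {a,b,c}"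
    using simplex_2_obtain[OF assms] by metis
  define u1 u2 v1 v2 where "u1 = (b-a)$1" and "u2 = (b-a)$2" and "v1 = (c-a)$1" and "v2 = (c-a)$2"
  define D where "D = u1 * v2 - u2 * v1"
  define p q where "p = (u1\<^sup>2 + u2\<^sup>2) / 2" and "q = (v1\<^sup>2 + v2\<^sup>2) / 2"
  have D: "D \<noteq> 0"
    using noncollinear_det[OF nc] by (simp add: D_def u1_def u2_def v1_def v2_def)
  have eq: "(\<exists>r. \<forall>v\<in>vertices_of T. dist z v = r) \<longleftrightarrow>
      (z-a)$1 * u1 + (z-a)$2 * u2 = p \<and> (z-a)$1 * v1 + (z-a)$2 * v2 = q" for z
  proof -
    have "(\<exists>r. \<forall>v\<in>vertices_of T. dist z v = r) \<longleftrightarrow> dist z a = dist z b \<and> dist z a = dist z c"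
      unfolding V by auto
    then show ?thesis
      unfolding dist_eq_iff_2 p_def q_def u1_def u2_def v1_def v2_def
      by (simp add: eq_divide_eq mult.commute)
  qed
  have lin: "x * u1 + y * u2 = p \<and> x * v1 + y * v2 = q \<longleftrightarrow>
      x = (p * v2 - q * u2) / D \<and> y = (q * u1 - p * v1) / D" for x y
  proof
    assume "x * u1 + y * u2 = p \<and> x * v1 + y * v2 = q"
    then have pq: "p = x * u1 + y * u2" "q = x * v1 + y * v2" by auto
    have "x * D = p * v2 - q * u2" "y * D = q * u1 - p * v1"
      unfolding D_def pq by (simp_all add: algebra_simps)
    then show "x = (p * v2 - q * u2) / D \<and> y = (q * u1 - p * v1) / D"
      using D by (simp add: eq_divide_eq)
  next
    assume "x = (p * v2 - q * u2) / D \<and> y = (q * u1 - p * v1) / D"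
    then have xy: "x * D = p * v2 - q * u2" "y * D = q * u1 - p * v1"
      using D by (simp_all add: eq_divide_eq)
    have "(x * u1 + y * u2) * D = (x * D) * u1 + (y * D) * u2"
      "(x * v1 + y * v2) * D = (x * D) * v1 + (y * D) * v2"
      by (simp_all add: algebra_simps)
    then have "(x * u1 + y * u2) * D = p * D" "(x * v1 + y * v2) * D = q * D"
      unfolding xy by (simp_all add: D_def algebra_simps)
    then show "x * u1 + y * u2 = p \<and> x * v1 + y * v2 = q" using D by simp
  qed
  define w :: "real^2" where "w = vector [(p * v2 - q * u2) / D, (q * u1 - p * v1) / D]"
  have "(\<exists>r. \<forall>v\<in>vertices_of T. dist z v = r) \<longleftrightarrow> z = a + w" for z
    unfolding eq lin by (auto simp: vec_eq_iff forall_2 w_def vector_2)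
  then show ?thesis by auto
qed

lemma circumradius_iff:
  fixes T :: "(real^2) set"
  assumes "2 simplex T"
  shows "(\<forall>v\<in>vertices_of T. dist z v = r) \<longleftrightarrow> z = circumcenter T \<and> r = circumradius T"
proof -
  have V: "vertices_of T \<noteq> {}" using simplex_2_obtain[OF assms] by (metis insert_not_empty)
  have cc: "\<exists>r. \<forall>v\<in>vertices_of T. dist (circumcenter T) v = r"
    unfolding circumcenter_def by (rule theI'[OF circumcenter_ex1[OF assms]])
  then obtain s where s: "\<forall>v\<in>vertices_of T. dist (circumcenter T) v = s" by blast
  then have "circumradius T = s"
    unfolding circumradius_def using V by (intro the_equality) auto
  moreover have "z = circumcenter T" if "\<forall>v\<in>vertices_of T. dist z v = r"
    using that cc circumcenter_ex1[OF assms] by blast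
  ultimately show ?thesis using s V by (metis ex_in_conv)
qed

lemma circumradius_pos:
  assumes "2 simplex T"
  shows "circumradius T > 0"
proof -
  obtain a b c where nc: "\<not> collinear {a,b,c}" and V: "vertices_of T = {a,b,c}"
    using simplex_2_obtain[OF assms] by metis
  then have "a \<noteq> b" by auto
  moreover have "dist (circumcenter T) a = circumradius T" "dist (circumcenter T) b = circumradius T"
    using circumradius_iff[OF assms, of "circumcenter T" "circumradius T"] V by auto
  ultimately show ?thesis by (metis dist_eq_0_iff zero_less_dist_iff)
qed


text \<open>
  Delaunay triangles are dual to the Voronoi vertices: three sites span a Delaunay
  triangle iff their Voronoi cells have a common point.
\<close>

definition voronoi_cell :: "(real^2) set \<Rightarrow> real^2 \<Rightarrow> (real^2) set" where
  "voronoi_cell S a = {x. \<forall>b\<in>S. dist x a \<le> dist x b}"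

lemma delaunay_iff_voronoi:
  "T \<in> delaunay S \<longleftrightarrow>
     2 simplex T \<and> vertices_of T \<subseteq> S \<and> (\<Inter>v\<in>vertices_of T. voronoi_cell S v) \<noteq> {}"
proof (cases "2 simplex T \<and> vertices_of T \<subseteq> S")
  case True
  then have T: "2 simplex T" and VS: "vertices_of T \<subseteq> S" by auto
  have V: "vertices_of T \<noteq> {}" using simplex_2_obtain[OF T] by (metis insert_not_empty)
  have cr: "dist (circumcenter T) v = circumradius T" if "v \<in> vertices_of T" for v
    using circumradius_iff[OF T, of "circumcenter T" "circumradius T"] that by auto
  have "ball (circumcenter T) (circumradius T) \<inter> S = {} \<longleftrightarrow>
        (\<Inter>v\<in>vertices_of T. voronoi_cell S v) \<noteq> {}"
  proof
    assume "ball (circumcenter T) (circumradius T) \<inter> S = {}"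
    then have "circumcenter T \<in> (\<Inter>v\<in>vertices_of T. voronoi_cell S v)"
      using cr by (auto simp: voronoi_cell_def disjoint_iff not_less)
    then show "(\<Inter>v\<in>vertices_of T. voronoi_cell S v) \<noteq> {}" by blast
  next
    assume "(\<Inter>v\<in>vertices_of T. voronoi_cell S v) \<noteq> {}"
    then obtain x where x: "\<And>v b. v \<in> vertices_of T \<Longrightarrow> b \<in> S \<Longrightarrow> dist x v \<le> dist x b"
      by (auto simp: voronoi_cell_def)
    obtain w where w: "w \<in> vertices_of T" using V by blast
    have "\<forall>v\<in>vertices_of T. dist x v = dist x w"
      using x VS w by (meson order_antisym subsetD)
    then have "x = circumcenter T" "dist x w = circumradius T"
      using circumradius_iff[OF T] by auto
    then show "ball (circumcenter T) (circumradius T) \<inter> S = {}"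
      using x[OF w] by (fastforce simp: disjoint_iff)
  qed
  then show ?thesis using True by (simp add: delaunay_def)
qed (auto simp: delaunay_def)

lemma finite_delaunay:
  assumes "finite S"
  shows "finite (delaunay S)"
proof (rule finite_subset)
  show "delaunay S \<subseteq> (\<lambda>C. convex hull C) ` Pow S"
  proof
    fix T assume "T \<in> delaunay S"
    then have T: "2 simplex T" "vertices_of T \<subseteq> S" by (auto simp: delaunay_def)
    obtain a b c where "T = convex hull {a,b,c}" "vertices_of T = {a,b,c}"
      using simplex_2_obtain[OF T(1)] by metis
    then show "T \<in> (\<lambda>C. convex hull C) ` Pow S" using T(2) by (metis Pow_iff imageI)
  qed
qed (use assms in simp)

end

theory Submission
  imports Defs "HOL-Library.Multiset"
begin

text \<open>
  Lawson flips, performed on multisets of triangles instead of triangulations. What is kept of a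
  triangulation is that no triangle contains a site other than its vertices, that the triangles
  cover the hull and have the right total area, and that their directed edges cancel inside the
  hull. All of this is preserved when the diagonal \<open>ac\<close> of \<open>abcd\<close> is replaced by \<open>bd\<close> for purely
  algebraic reasons. If \<open>d\<close> lies in the circumdisk of \<open>abc\<close>, the two new circumradii can be matched
  with the two old ones so that each gets smaller; hence a multiset minimizing the sum of the
  circumradii admits no such flip.

  Without flips, the power of a site \<open>s\<close> with respect to the circumcircles strictly increases when
  passing to the neighbour across an edge that separates a triangle from \<open>s\<close>. So its maximum is
  attained at a triangle containing \<open>s\<close>, of which \<open>s\<close> is a vertex, and it is \<open>0\<close>: every triangle is
  Delaunay. Covering and total area then force every Delaunay triangle to occur exactly once.
\<close>

subsection \<open>Orientation\<close>

text \<open>Twice the signed area of \<open>abc\<close>, positive for counterclockwise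
  labellings.\<close>

definition orient :: "real^2 \<Rightarrow> real^2 \<Rightarrow> real^2 \<Rightarrow> real" where
  "orient a b c = (b-a)$1 * (c-a)$2 - (b-a)$2 * (c-a)$1"

lemma orient_swap: "orient b a c = - orient a b c"
  by (simp add: orient_def algebra_simps)

lemma orient_same [simp]: "orient a a b = 0" "orient a b a = 0" "orient a b b = 0"
  by (simp_all add: orient_def algebra_simps)

lemma orient_pos_distinct:
  assumes "orient a b c > 0"
  shows "a \<noteq> b" "b \<noteq> c" "a \<noteq> c"
  using assms by auto

lemma orient_comb:
  assumes "u + v + w = 1"
  shows "orient p q (u *\<^sub>R a + v *\<^sub>R b + w *\<^sub>R c) = u * orient p q a + v * orient p q b + w * orient p q c"
proof -
  have u: "u = 1 - v - w" using assms by simp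
  show ?thesis unfolding u orient_def by (simp add: algebra_simps)
qed

text \<open>Cramer's rule with the denominator cleared: the coefficients are the barycentric
  coordinates of \<open>x\<close>, scaled by \<open>orient a b c\<close>.\<close>

lemma barycentric:
  "orient a b c *\<^sub>R x = orient b c x *\<^sub>R a + orient c a x *\<^sub>R b + orient a b x *\<^sub>R c"
  by (simp add: vec_eq_iff forall_2 orient_def algebra_simps)

lemma orient_sum: "orient b c x + orient c a x + orient a b x = orient a b c"
  by (simp add: orient_def algebra_simps)

lemma mem_triangle:
  assumes "orient a b c > 0"
  shows "x \<in> convex hull {a,b,c} \<longleftrightarrow> orient a b x \<ge> 0 \<and> orient b c x \<ge> 0 \<and> orient c a x \<ge> 0"
proof
  assume "x \<in> convex hull {a,b,c}"
  then obtain u v w where x: "x = u *\<^sub>R a + v *\<^sub>R b + w *\<^sub>R c" "0 \<le> u" "0 \<le> v" "0 \<le> w" "u + v + w = 1"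
    by (auto simp: convex_hull_3)
  have "orient b c a = orient a b c" "orient c a b = orient a b c"
    by (simp_all add: orient_def algebra_simps)
  then show "orient a b x \<ge> 0 \<and> orient b c x \<ge> 0 \<and> orient c a x \<ge> 0"
    using x assms by (simp add: orient_comb)
next
  assume *: "orient a b x \<ge> 0 \<and> orient b c x \<ge> 0 \<and> orient c a x \<ge> 0"
  let ?D = "orient a b c"
  have "x = (1 / ?D) *\<^sub>R (?D *\<^sub>R x)" using assms by simp
  also have "\<dots> = (orient b c x / ?D) *\<^sub>R a + (orient c a x / ?D) *\<^sub>R b + (orient a b x / ?D) *\<^sub>R c"
    unfolding barycentric[of a b c x] by (simp add: scaleR_add_right)
  finally have x: "x = (orient b c x / ?D) *\<^sub>R a + (orient c a x / ?D) *\<^sub>R b + (orient a b x / ?D) *\<^sub>R c" .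
  have "orient b c x / ?D + orient c a x / ?D + orient a b x / ?D = 1"
    using orient_sum[of b c x a] assms by (simp flip: add_divide_distrib)
  then show "x \<in> convex hull {a,b,c}"
    unfolding convex_hull_3 using x * assms by (smt (verit) mem_Collect_eq divide_nonneg_pos)
qed

lemma orient_nonzero_noncollinear:
  assumes "orient a b c \<noteq> 0"
  shows "\<not> collinear {a,b,c}"
proof
  assume "collinear {a,b,c}"
  then have "collinear {0, b - a, c - a}"
    using collinear_3[of b a c] by (auto simp: insert_commute)
  then have "b - a = 0 \<or> c - a = 0 \<or> (\<exists>k. c - a = k *\<^sub>R (b - a))"
    by (simp add: collinear_lemma)
  then have "orient a b c = 0"
  proof (elim disjE exE)
    fix k assume "c - a = k *\<^sub>R (b - a)"
    then have "(c - a)$i = k * (b - a)$i" for i by simp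
    then show ?thesis unfolding orient_def by simp
  qed (auto simp: orient_def)
  then show False using assms by simp
qed

lemma triangle_simplex:
  assumes "orient a b c \<noteq> 0"
  shows "2 simplex (convex hull {a,b,c})" "vertices_of (convex hull {a,b,c}) = {a,b,c}"
proof -
  have n: "\<not> collinear {a,b,c}" by (rule orient_nonzero_noncollinear[OF assms])
  then have d: "a \<noteq> b" "b \<noteq> c" "a \<noteq> c" by (auto simp: insert_commute)
  then have ad: "\<not> affine_dependent {a,b,c}"
    using n by (simp add: collinear_3_eq_affine_dependent)
  then show "2 simplex (convex hull {a,b,c})"
    unfolding simplex_def using d by (intro exI[of _ "{a,b,c}"]) auto
  show "vertices_of (convex hull {a,b,c}) = {a,b,c}"
    using ad by (auto simp: vertices_of_def extreme_point_of_convex_hull_affine_independent)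
qed

lemma simplex_oriented:
  assumes "2 simplex (T :: (real^2) set)"
  obtains a b c where "orient a b c > 0" "T = convex hull {a,b,c}" "vertices_of T = {a,b,c}"
proof -
  obtain a b c where *: "\<not> collinear {a,b,c}" "T = convex hull {a,b,c}" "vertices_of T = {a,b,c}"
    using simplex_2_obtain[OF assms] by metis
  have "orient a b c \<noteq> 0" using noncollinear_det[OF *(1)] by (simp add: orient_def)
  then consider "orient a b c > 0" | "orient b a c > 0"
    by (force simp: orient_swap[of b a c])
  then show thesis
    using that * by cases (auto simp: insert_commute)
qed

lemma measure_triangle:
  "measure lebesgue (convex hull {a,b,c}) = \<bar>orient a b c\<bar> / 2"
proof -
  have "convex hull {a,b,c} \<in> sets lborel"
    by (simp add: borel_closed compact_imp_closed finite_imp_compact_convex_hull)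
  then show ?thesis
    by (simp add: content_triangle orient_def algebra_simps abs_minus_commute)
qed

subsection \<open>Circumscribed circles\<close>

text \<open>The usual power of a point with the sign reversed: positive inside the
  circumcircle.\<close>

definition circle_power :: "(real^2) set \<Rightarrow> real^2 \<Rightarrow> real" where
  "circle_power T x = (circumradius T)\<^sup>2 - (dist (circumcenter T) x)\<^sup>2"

lemma dist_circumcenter:
  assumes "2 simplex T" "v \<in> vertices_of T"
  shows "dist (circumcenter T) v = circumradius T"
  using circumradius_iff[OF assms(1), of "circumcenter T" "circumradius T"] assms(2) by auto

lemma circle_power_vertex: "2 simplex T \<Longrightarrow> v \<in> vertices_of T \<Longrightarrow> circle_power T v = 0"
  by (simp add: circle_power_def dist_circumcenter)

lemma circle_power_pos_iff:
  assumes "2 simplex T"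
  shows "circle_power T x > 0 \<longleftrightarrow> x \<in> ball (circumcenter T) (circumradius T)"
  using circumradius_pos[OF assms]
  by (auto simp: circle_power_def intro: power_strict_mono power2_less_imp_less)

lemma circle_power_zero_iff:
  assumes "2 simplex T"
  shows "circle_power T x = 0 \<longleftrightarrow> x \<in> sphere (circumcenter T) (circumradius T)"
  using circumradius_pos[OF assms]
  by (auto simp: circle_power_def)

lemma dist_sq_2: "(dist x y)\<^sup>2 = (x$1 - y$1)\<^sup>2 + (x$2 - y$2)\<^sup>2" for x y :: "real^2"
  unfolding dist_norm power2_norm_eq_inner inner_vec_def sum_2 by (simp add: power2_eq_square)

text \<open>All circle powers share the quadratic part \<open>- (norm x)\<^sup>2\<close>, whence the
  last term, as in Stewart's theorem. Negative weights are allowed: \<open>illegal_edge\<close>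
  applies this before the signs of its weights are known.\<close>

lemma circle_power_segment:
  assumes "r + s = 1"
  shows "circle_power T (r *\<^sub>R x + s *\<^sub>R y) = r * circle_power T x + s * circle_power T y + r * s * (dist x y)\<^sup>2"
proof -
  have r: "r = 1 - s" using assms by simp
  show ?thesis unfolding circle_power_def dist_sq_2 r
    by (simp add: power2_eq_square algebra_simps)
qed

text \<open>The common quadratic part cancels, so the difference is affine; for different centers
  its zero set is the radical axis.\<close>

lemma circle_power_diff_comb:
  assumes "u + v + w = 1"
  shows "circle_power T (u *\<^sub>R a + v *\<^sub>R b + w *\<^sub>R c) - circle_power T' (u *\<^sub>R a + v *\<^sub>R b + w *\<^sub>R c) =
    u * (circle_power T a - circle_power T' a) + v * (circle_power T b - circle_power T' b) + w * (circle_power T c - circle_power T' c)"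
proof -
  have u: "u = 1 - v - w" using assms by simp
  show ?thesis unfolding circle_power_def dist_sq_2 u
    by (simp add: power2_eq_square algebra_simps)
qed

text \<open>The difference of the two powers is affine and vanishes on the line \<open>ac\<close>.
  At \<open>d\<close> it equals \<open>- circle_power T d\<close>, which is positive, and
  \<open>s\<close> lies on the same side of that line as \<open>d\<close>.\<close>

lemma circle_power_increases:
  assumes T: "2 simplex T" "a \<in> vertices_of T" "c \<in> vertices_of T"
    and T': "2 simplex T'" "a \<in> vertices_of T'" "c \<in> vertices_of T'" "d \<in> vertices_of T'"
    and "orient a c d < 0" "circle_power T d < 0" "orient a c s < 0"
  shows "circle_power T s < circle_power T' s"
proof -
  let ?D = "orient a c d"
  have D: "?D \<noteq> 0" using assms by simp
  have "s = (1 / ?D) *\<^sub>R (?D *\<^sub>R s)" using D by simp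
  also have "\<dots> = (orient c d s / ?D) *\<^sub>R a + (orient d a s / ?D) *\<^sub>R c + (orient a c s / ?D) *\<^sub>R d"
    unfolding barycentric[of a c d s] by (simp add: scaleR_add_right)
  finally have s: "s = (orient c d s / ?D) *\<^sub>R a + (orient d a s / ?D) *\<^sub>R c + (orient a c s / ?D) *\<^sub>R d" .
  have "orient c d s / ?D + orient d a s / ?D + orient a c s / ?D = 1"
    using orient_sum[of c d s a] D by (simp flip: add_divide_distrib)
  from circle_power_diff_comb[OF this, of T' a c d T, folded s]
  have "circle_power T' s - circle_power T s = orient a c s / ?D * (- circle_power T d)"
    using assms by (simp add: circle_power_vertex)
  also have "\<dots> > 0"
    using assms by (intro mult_pos_pos divide_neg_neg) auto
  finally show ?thesis by simp
qed

text \<open>The circumradius is the product of the sides over four times the area; here squared and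
  cleared of denominators.\<close>

lemma circumradius_sq:
  assumes "orient a b c \<noteq> 0"
  shows "4 * (orient a b c)\<^sup>2 * (circumradius (convex hull {a,b,c}))\<^sup>2 =
     (dist a b)\<^sup>2 * (dist b c)\<^sup>2 * (dist c a)\<^sup>2"
proof -
  let ?T = "convex hull {a,b,c}"
  note T = triangle_simplex[OF assms]
  define x y where "x = (circumcenter ?T - a)$1" and "y = (circumcenter ?T - a)$2"
  define u1 u2 v1 v2 where "u1 = (b-a)$1" and "u2 = (b-a)$2" and "v1 = (c-a)$1" and "v2 = (c-a)$2"
  have d: "dist (circumcenter ?T) a = circumradius ?T" "dist (circumcenter ?T) a = dist (circumcenter ?T) b"
     "dist (circumcenter ?T) a = dist (circumcenter ?T) c"
    using dist_circumcenter[OF T(1)] unfolding T(2) by auto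
  have R: "(circumradius ?T)\<^sup>2 = x\<^sup>2 + y\<^sup>2"
    unfolding d(1)[symmetric] dist_sq_2 x_def y_def by simp
  have e1: "2 * (x * u1 + y * u2) = u1\<^sup>2 + u2\<^sup>2" and e2: "2 * (x * v1 + y * v2) = v1\<^sup>2 + v2\<^sup>2"
    using d(2,3) unfolding dist_eq_iff_2 x_def y_def u1_def u2_def v1_def v2_def by auto
  have o: "orient a b c = u1 * v2 - u2 * v1"
    unfolding orient_def u1_def u2_def v1_def v2_def ..
  have ab: "(dist a b)\<^sup>2 = u1\<^sup>2 + u2\<^sup>2" "(dist c a)\<^sup>2 = v1\<^sup>2 + v2\<^sup>2" "(dist b c)\<^sup>2 = (u1-v1)\<^sup>2 + (u2-v2)\<^sup>2"
    unfolding dist_sq_2 u1_def u2_def v1_def v2_def by (simp_all add: power2_eq_square algebra_simps)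
  show ?thesis unfolding R o ab using e1 e2 by algebra
qed

text \<open>
  The quadrilateral \<open>abcd\<close> is described by the intersection point \<open>o'\<close> of its diagonals; the last
  assumption says that \<open>d\<close> is inside the circumcircle of \<open>abc\<close>. Reflecting \<open>u\<close> or \<open>w\<close> yields the
  other comparisons between old and new triangles.
\<close>

lemma circumradius_less:
  fixes a b c d o' u w :: "real^2" and p q r s :: real
  assumes a: "a = o' - p *\<^sub>R u" and b: "b = o' - s *\<^sub>R w" and c: "c = o' + q *\<^sub>R u" and d: "d = o' + r *\<^sub>R w"
    and pos: "p > 0" "q > 0" "r > 0" "s > 0"
    and uw: "u$1 * w$2 - u$2 * w$1 \<noteq> 0" "u \<bullet> w \<ge> 0"
    and pw: "r * s * (norm w)\<^sup>2 < p * q * (norm u)\<^sup>2"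
  shows "circumradius (convex hull {a,b,d}) < circumradius (convex hull {a,b,c})"
proof -
  define K where "K = u$1 * w$2 - u$2 * w$1"
  define k P Q where "k = u \<bullet> w" and "P = (norm u)\<^sup>2" and "Q = (norm w)\<^sup>2"
  define R1 R2 where "R1 = circumradius (convex hull {a,b,c})" and "R2 = circumradius (convex hull {a,b,d})"
  have comp: "k = u$1 * w$1 + u$2 * w$2" "P = (u$1)\<^sup>2 + (u$2)\<^sup>2" "Q = (w$1)\<^sup>2 + (w$2)\<^sup>2"
    unfolding k_def P_def Q_def power2_norm_eq_inner inner_vec_def sum_2
    by (simp_all add: power2_eq_square)
  have o: "orient a b c = s * (p + q) * K" "orient a b d = p * (r + s) * K"
    unfolding orient_def a b c d K_def by (simp_all add: algebra_simps)
  have K: "K \<noteq> 0" using uw K_def by simp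
  have ne: "orient a b c \<noteq> 0" "orient a b d \<noteq> 0"
    using o K pos by auto
  define AB BC DA where "AB = p\<^sup>2 * P - 2 * p * s * k + s\<^sup>2 * Q" and
    "BC = q\<^sup>2 * P + 2 * q * s * k + s\<^sup>2 * Q" and "DA = r\<^sup>2 * Q + 2 * p * r * k + p\<^sup>2 * P"
  have ds: "(dist a b)\<^sup>2 = AB" "(dist b c)\<^sup>2 = BC" "(dist d a)\<^sup>2 = DA" 
    "(dist c a)\<^sup>2 = (p+q)\<^sup>2 * P" "(dist b d)\<^sup>2 = (r+s)\<^sup>2 * Q"
    unfolding dist_sq_2 AB_def BC_def DA_def a b c d comp
    by (simp_all add: power2_eq_square algebra_simps)
  have AB: "AB > 0" using ne unfolding ds(1)[symmetric] by (auto simp: orient_def)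
  have e1: "4 * (s * (p + q) * K)\<^sup>2 * R1\<^sup>2 = AB * BC * ((p+q)\<^sup>2 * P)"
    using circumradius_sq[OF ne(1)] unfolding ds o R1_def .
  have e2: "4 * (p * (r + s) * K)\<^sup>2 * R2\<^sup>2 = AB * ((r+s)\<^sup>2 * Q) * DA"
    using circumradius_sq[OF ne(2)] unfolding ds o R2_def .
  have "(p+q)\<^sup>2 * (4 * s\<^sup>2 * K\<^sup>2 * R1\<^sup>2) = (p+q)\<^sup>2 * (AB * BC * P)"
    using e1 by algebra
  then have E1: "4 * s\<^sup>2 * K\<^sup>2 * R1\<^sup>2 = AB * BC * P"
    using pos by simp
  have "(r+s)\<^sup>2 * (4 * p\<^sup>2 * K\<^sup>2 * R2\<^sup>2) = (r+s)\<^sup>2 * (AB * DA * Q)"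
    using e2 by algebra
  then have E2: "4 * p\<^sup>2 * K\<^sup>2 * R2\<^sup>2 = AB * DA * Q"
    using pos by simp
  \<comment> \<open>This product is \<open>p\<^sup>2 * BC * P - s\<^sup>2 * DA * Q\<close> in
    factored form. The first factor is positive by the circle condition, the second because
    \<open>u\<close> and \<open>w\<close> do not form an obtuse angle.\<close>
  have "0 < (p * q * P - r * s * Q) * (p * q * P + r * s * Q + 2 * p * s * k)"
    using pw pos uw unfolding P_def Q_def k_def
    by (intro mult_pos_pos add_pos_nonneg) (auto intro: add_pos_nonneg)
  then have key: "s\<^sup>2 * DA * Q < p\<^sup>2 * BC * P"
    unfolding DA_def BC_def by (simp add: power2_eq_square algebra_simps)
  have "(4 * p\<^sup>2 * s\<^sup>2 * K\<^sup>2) * R2\<^sup>2 = AB * (s\<^sup>2 * DA * Q)"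
    using E2 by algebra
  also have "\<dots> < AB * (p\<^sup>2 * BC * P)" using key AB by simp
  also have "\<dots> = (4 * p\<^sup>2 * s\<^sup>2 * K\<^sup>2) * R1\<^sup>2" using E1 by algebra
  finally have "R2\<^sup>2 < R1\<^sup>2" using pos K by (simp add: mult_less_cancel_left)
  moreover have "R1 > 0" unfolding R1_def using circumradius_pos triangle_simplex ne by blast
  ultimately have "R2 < R1" by (meson less_eq_real_def power2_less_imp_less)
  then show ?thesis by (simp add: R1_def R2_def)
qed

subsection \<open>Flips\<close>

text \<open>A point of \<open>abc\<close> is on the inner side of all four sides of the convex
  quadrilateral \<open>abcd\<close>. The sign of \<open>orient b d x\<close> then decides which
  triangle at the diagonal \<open>bd\<close> contains it.\<close>

lemma quadrilateral_cover_half: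
  assumes pos: "orient a b c > 0" "orient a c d > 0" "orient a b d > 0" "orient b c d > 0"
    and x: "x \<in> convex hull {a,b,c}"
  shows "x \<in> convex hull {a,b,d} \<union> convex hull {b,c,d}"
proof -
  obtain u v w where uvw: "x = u *\<^sub>R a + v *\<^sub>R b + w *\<^sub>R c" "0 \<le> u" "0 \<le> v" "0 \<le> w" "u + v + w = 1"
    using x by (auto simp: convex_hull_3)
  have o: "orient d a b = orient a b d" "orient d a c = orient a c d" "orient c d a = orient a c d"
    "orient c d b = orient b c d" "orient b c a = orient a b c" "orient d b x = - orient b d x"
    by (simp_all add: orient_def algebra_simps)
  have "orient a b x \<ge> 0" "orient d a x \<ge> 0" "orient b c x \<ge> 0" "orient c d x \<ge> 0"
    using uvw pos by (simp_all add: orient_comb o)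
  then show ?thesis
    using pos by (auto simp: mem_triangle o)
qed

text \<open>Each of the four triangles is covered by the pair at the other diagonal: this is the
  preceding lemma under the cyclic relabellings of \<open>abcd\<close>.\<close>

lemma quadrilateral_cover:
  assumes "orient a b c > 0" "orient a c d > 0" "orient a b d > 0" "orient b c d > 0"
  shows "convex hull {a,b,c} \<union> convex hull {a,c,d} = convex hull {a,b,d} \<union> convex hull {b,c,d}"
proof -
  have o: "orient c d a = orient a c d" "orient c a b = orient a b c" "orient c d b = orient b c d"
    "orient d a b = orient a b d" "orient b d a = orient a b d" "orient b c a = orient a b c"
    "orient d b c = orient b c d" "orient d a c = orient a c d"
    by (simp_all add: orient_def algebra_simps)
  have h: "{c,d,a} = {a,c,d}" "{c,d,b} = {b,c,d}" "{d,a,b} = {a,b,d}" "{b,c,a} = {a,b,c}"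
     "{d,a,c} = {a,c,d}" "{b,d,a} = {a,b,d}" "{d,b,c} = {b,c,d}" "{c,a,b} = {a,b,c}"
    by auto
  have "x \<in> convex hull {a,b,d} \<union> convex hull {b,c,d}" if "x \<in> convex hull {a,b,c}" for x
    using quadrilateral_cover_half[of a b c d x] assms that by blast
  moreover have "x \<in> convex hull {b,c,d} \<union> convex hull {a,b,d}" if "x \<in> convex hull {a,c,d}" for x
    using quadrilateral_cover_half[of c d a b x, unfolded o h] assms that by blast
  moreover have "x \<in> convex hull {a,b,c} \<union> convex hull {a,c,d}" if "x \<in> convex hull {b,c,d}" for x
    using quadrilateral_cover_half[of b c d a x, unfolded o h] assms that by blast
  moreover have "x \<in> convex hull {a,c,d} \<union> convex hull {a,b,c}" if "x \<in> convex hull {a,b,d}" for x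
    using quadrilateral_cover_half[of d a b c x, unfolded o h] assms that by blast
  ultimately show ?thesis by blast
qed

section \<open>Directed boundary edges of triangles\<close>

definition left_edge :: "real^2 \<Rightarrow> real^2 \<Rightarrow> (real^2) set \<Rightarrow> bool" where
  "left_edge a c T \<longleftrightarrow> (\<exists>b. orient a c b > 0 \<and> T = convex hull {a,c,b})"

lemma left_edge_triangle:
  assumes "orient a b c > 0"
  shows "left_edge p q (convex hull {a,b,c}) \<longleftrightarrow> (p,q) = (a,b) \<or> (p,q) = (b,c) \<or> (p,q) = (c,a)"
proof
  assume "left_edge p q (convex hull {a,b,c})"
  then obtain x where x: "orient p q x > 0" "convex hull {a,b,c} = convex hull {p,q,x}"
    unfolding left_edge_def by auto
  have "vertices_of (convex hull {a,b,c}) = {a,b,c}" "vertices_of (convex hull {p,q,x}) = {p,q,x}"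
    using x(1) assms triangle_simplex(2)[of a b c] triangle_simplex(2)[of p q x] by linarith+
  then have eq: "{a,b,c} = {p,q,x}"
    unfolding x(2) by (rule trans[OF sym])
  have neg: "\<not> orient a c b > 0" "\<not> orient c b a > 0" "\<not> orient b a c > 0"
    using assms by (simp_all add: orient_def algebra_simps)
  have "p \<in> {a,b,c}" "q \<in> {a,b,c}" "x \<in> {a,b,c}" unfolding eq by auto
  moreover have "p \<noteq> q" "q \<noteq> x" "p \<noteq> x" using orient_pos_distinct[OF x(1)] by auto
  ultimately show "(p,q) = (a,b) \<or> (p,q) = (b,c) \<or> (p,q) = (c,a)"
    using x(1) neg by (elim insertE emptyE) simp_all
next
  have o: "orient b c a > 0" "orient c a b > 0"
    using assms by (simp_all add: orient_def algebra_simps)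
  have h: "{b,c,a} = {a,b,c}" "{c,a,b} = {a,b,c}" by auto
  have "left_edge a b (convex hull {a,b,c})" "left_edge b c (convex hull {b,c,a})"
    "left_edge c a (convex hull {c,a,b})"
    using o assms unfolding left_edge_def by blast+
  then show "left_edge p q (convex hull {a,b,c})"
    if "(p,q) = (a,b) \<or> (p,q) = (b,c) \<or> (p,q) = (c,a)"
    using that unfolding h by blast
qed

text \<open>The coefficient of the directed edge \<open>ac\<close> in the boundary of the
  counterclockwise triangle, as in simplicial chains: an edge shared by triangles on opposite sides
  cancels in sums.\<close>

definition edge_sign :: "real^2 \<Rightarrow> real^2 \<Rightarrow> (real^2) set \<Rightarrow> int" where
  "edge_sign a c T = of_bool (left_edge a c T) - of_bool (left_edge c a T)"

definition pair_sign :: "real^2 \<Rightarrow> real^2 \<Rightarrow> real^2 \<Rightarrow> real^2 \<Rightarrow> int" where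
  "pair_sign p q a b = of_bool (p = a \<and> q = b) - of_bool (p = b \<and> q = a)"

lemma pair_sign_swap: "pair_sign p q b a = - pair_sign p q a b"
  by (simp add: pair_sign_def)

lemma edge_sign_triangle:
  assumes "orient a b c > 0"
  shows "edge_sign p q (convex hull {a,b,c}) = pair_sign p q a b + pair_sign p q b c + pair_sign p q c a"
  unfolding edge_sign_def left_edge_triangle[OF assms] pair_sign_def prod.inject
  using orient_pos_distinct[OF assms]
  by (cases "p = a"; cases "p = b"; cases "p = c"; cases "q = a"; cases "q = b"; cases "q = c") simp_all

text \<open>Both pairs have the boundary of the quadrilateral as their boundary; the diagonal occurs
  once in either direction and cancels.\<close>

lemma edge_sign_flip:
  assumes "orient a b c > 0" "orient a c d > 0" "orient a b d > 0" "orient b c d > 0"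
  shows "edge_sign p q (convex hull {a,b,c}) + edge_sign p q (convex hull {a,c,d}) =
         edge_sign p q (convex hull {a,b,d}) + edge_sign p q (convex hull {b,c,d})"
  using assms pair_sign_swap[of p q c a] pair_sign_swap[of p q d b]
  by (simp add: edge_sign_triangle)

text \<open>The power of the intersection point of the diagonals, computed along both of them,
  yields one inequality. It forces \<open>abcd\<close> to be convex and is also the main hypothesis
  of \<open>circumradius_less\<close>.\<close>

lemma illegal_edge:
  assumes abc: "orient a b c > 0" and acd: "orient a c d > 0"
    and pow: "circle_power (convex hull {a,b,c}) d > 0"
  shows "orient a b d > 0" "orient b c d > 0"
    "circumradius (convex hull {a,b,d}) < circumradius (convex hull {a,b,c}) \<and>
     circumradius (convex hull {b,c,d}) < circumradius (convex hull {a,c,d}) \<or>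
     circumradius (convex hull {a,b,d}) < circumradius (convex hull {a,c,d}) \<and>
     circumradius (convex hull {b,c,d}) < circumradius (convex hull {a,b,c})"
proof -
  let ?T = "convex hull {a,b,c}"
  define D where "D = orient a b c + orient a c d"
  \<comment> \<open>These ratios of areas are the weights that express the intersection point
    \<open>z\<close> of the lines \<open>ac\<close> and \<open>bd\<close> in the endpoints of either
    diagonal. The signs of \<open>p\<close> and \<open>q\<close> are not known yet.\<close>
  define p q r s where "p = orient a b d / D" and "q = orient b c d / D"
    and "r = orient a c d / D" and "s = orient a b c / D"
  have D: "D > 0" "D = orient a b d + orient b c d"
    using abc acd unfolding D_def by (auto simp: orient_def algebra_simps)
  have pq: "p + q = 1" and rs: "r + s = 1" and rs0: "r > 0" "s > 0"
    using D abc acd by (auto simp: p_def q_def r_def s_def D_def simp flip: add_divide_distrib)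
  define z where "z = q *\<^sub>R a + p *\<^sub>R c"
  have dep: "orient b c d *\<^sub>R a + orient a b d *\<^sub>R c = orient a c d *\<^sub>R b + orient a b c *\<^sub>R d"
    by (simp add: vec_eq_iff forall_2 orient_def algebra_simps)
  have "z = (1 / D) *\<^sub>R (orient b c d *\<^sub>R a + orient a b d *\<^sub>R c)"
    unfolding z_def p_def q_def by (simp add: scaleR_add_right)
  also have "\<dots> = r *\<^sub>R b + s *\<^sub>R d"
    unfolding dep r_def s_def by (simp add: scaleR_add_right)
  finally have z2: "z = r *\<^sub>R b + s *\<^sub>R d" .
  have T: "2 simplex ?T" "vertices_of ?T = {a,b,c}" using triangle_simplex abc by auto
  have "q + p = 1" using pq by simp
  from circle_power_segment[OF this, of ?T a c] have P1: "circle_power ?T z = p * q * (dist a c)\<^sup>2"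
    unfolding z_def using T by (simp add: circle_power_vertex)
  have P2: "circle_power ?T z = s * circle_power ?T d + r * s * (dist b d)\<^sup>2"
    unfolding z2 using circle_power_segment[OF rs, of ?T b d] T by (simp add: circle_power_vertex)
  \<comment> \<open>Along \<open>ac\<close> both endpoints lie on the circle; along
    \<open>bd\<close> only \<open>b\<close> does, and \<open>d\<close> adds a positive
    amount.\<close>
  have lt: "r * s * (dist b d)\<^sup>2 < p * q * (dist a c)\<^sup>2"
    using P1 P2 mult_pos_pos[OF rs0(2) pow] by linarith
  moreover have "0 \<le> r * s * (dist b d)\<^sup>2" using rs0 by simp
  ultimately have "p * q > 0" by (smt (verit) mult_nonpos_nonneg zero_le_power2)
  then have pq0: "p > 0" "q > 0" using pq by (auto simp: zero_less_mult_iff)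
  then show abd: "orient a b d > 0" and bcd: "orient b c d > 0"
    using D(1) by (auto simp: p_def q_def zero_less_divide_iff)
  define u w where "u = c - a" and "w = d - b"
  have cross: "u$1 * w$2 - u$2 * w$1 = D"
    unfolding u_def w_def D_def orient_def by (simp add: algebra_simps)
  have norm: "r * s * (norm w)\<^sup>2 < p * q * (norm u)\<^sup>2"
    using lt by (simp add: u_def w_def dist_norm norm_minus_commute)
  have q: "q = 1 - p" and r: "r = 1 - s" using pq rs by auto
  have eqs: "a = z - p *\<^sub>R u" "c = z + q *\<^sub>R u"
    unfolding z_def u_def q by (simp_all add: algebra_simps)
  have eqs2: "b = z - s *\<^sub>R w" "d = z + r *\<^sub>R w"
    unfolding z2 w_def r by (simp_all add: algebra_simps)
  have h: "{b,c,d} = {c,d,b}" "{a,c,d} = {c,d,a}"  "{b,c,d} = {c,b,d}" "{a,b,c} = {c,b,a}"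
     "{a,b,d} = {a,d,b}" "{a,c,d} = {a,d,c}" by auto
  show "circumradius (convex hull {a,b,d}) < circumradius (convex hull {a,b,c}) \<and>
     circumradius (convex hull {b,c,d}) < circumradius (convex hull {a,c,d}) \<or>
     circumradius (convex hull {a,b,d}) < circumradius (convex hull {a,c,d}) \<and>
     circumradius (convex hull {b,c,d}) < circumradius (convex hull {a,b,c})"
  \<comment> \<open>The angle between the diagonals decides which matching works. In the first case
    the two comparisons differ by a half turn; in the second, one of \<open>u\<close> and
    \<open>w\<close> is negated to make the inner product nonnegative.\<close>
  proof (cases "u \<bullet> w \<ge> 0")
    case True
    have "circumradius (convex hull {a,b,d}) < circumradius (convex hull {a,b,c})"
      by (rule circumradius_less[OF eqs(1) eqs2(1) eqs(2) eqs2(2)])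
        (use pq0 rs0 True norm cross D in auto)
    moreover have "circumradius (convex hull {c,d,b}) < circumradius (convex hull {c,d,a})"
      by (rule circumradius_less[of c z q "-u" d r "-w" a p b s])
        (use eqs eqs2 pq0 rs0 True norm cross D in \<open>auto simp: mult.commute\<close>)
    ultimately show ?thesis unfolding h(1,2) by blast
  next
    case False
    have "circumradius (convex hull {c,b,d}) < circumradius (convex hull {c,b,a})"
      by (rule circumradius_less[of c z q "-u" b s "w" a p d r])
        (use eqs eqs2 pq0 rs0 False norm cross D in \<open>auto simp: mult.commute\<close>)
    moreover have "circumradius (convex hull {a,d,b}) < circumradius (convex hull {a,d,c})"
      by (rule circumradius_less[of a z p u d r "-w" c q b s])
        (use eqs eqs2 pq0 rs0 False norm cross D in \<open>auto simp: mult.commute\<close>)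
    ultimately show ?thesis unfolding h(3-6) by blast
  qed
qed

subsection \<open>Triangle multisets\<close>

text \<open>
  The edge condition refers to pairs with a site strictly to the right of \<open>ac\<close>, so hull edges are exempt.
\<close>

definition tri_chain :: "(real^2) set \<Rightarrow> (real^2) set multiset \<Rightarrow> bool" where
  "tri_chain S M \<longleftrightarrow>
     (\<forall>T\<in>#M. 2 simplex T \<and> vertices_of T \<subseteq> S \<and> T \<inter> S \<subseteq> vertices_of T) \<and>
     convex hull S \<subseteq> \<Union>(set_mset M) \<and>
     (\<forall>a c s. s \<in> S \<and> orient a c s < 0 \<longrightarrow> (\<Sum>T\<in>#M. edge_sign a c T) \<le> 0) \<and>
     (\<Sum>T\<in>#M. measure lebesgue T) = measure lebesgue (convex hull S)"

lemma tri_chain_flip: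
  assumes M: "tri_chain S (add_mset (convex hull {a,b,c}) (add_mset (convex hull {a,c,d}) N))"
    and pos: "orient a b c > 0" "orient a c d > 0" "orient a b d > 0" "orient b c d > 0"
  shows "tri_chain S (add_mset (convex hull {a,b,d}) (add_mset (convex hull {b,c,d}) N))"
proof -
  have V: "vertices_of (convex hull {a,b,c}) = {a,b,c}" "vertices_of (convex hull {a,c,d}) = {a,c,d}"
    "vertices_of (convex hull {a,b,d}) = {a,b,d}" "vertices_of (convex hull {b,c,d}) = {b,c,d}"
    and simp: "2 simplex (convex hull {a,b,d})" "2 simplex (convex hull {b,c,d})"
    using pos triangle_simplex by auto
  note cover = quadrilateral_cover[OF pos]
  have abcd: "{a,b,c,d} \<subseteq> S" using M V unfolding tri_chain_def by auto
  have in_S: "x \<in> {a,b,c,d}"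
    if "x \<in> S" "x \<in> convex hull {a,b,d} \<union> convex hull {b,c,d}" for x
    using that M V unfolding cover[symmetric] tri_chain_def by auto
  \<comment> \<open>The opposite vertices \<open>c\<close> and \<open>a\<close> lie strictly beyond
    the new diagonal, so neither new triangle contains the fourth site of the quadrilateral.\<close>
  have "orient b d c < 0" "orient d b a < 0"
    using pos by (simp_all add: orient_def algebra_simps)
  then have "c \<notin> convex hull {a,b,d}" "a \<notin> convex hull {b,c,d}"
    using pos by (simp_all add: mem_triangle)
  then have empty: "convex hull {a,b,d} \<inter> S \<subseteq> {a,b,d}" "convex hull {b,c,d} \<inter> S \<subseteq> {b,c,d}"
    using in_S by blast+
  have "orient a b c + orient a c d = orient a b d + orient b c d"
    by (simp add: orient_def algebra_simps)
  then have area: "measure lebesgue (convex hull {a,b,c}) + measure lebesgue (convex hull {a,c,d}) =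
      measure lebesgue (convex hull {a,b,d}) + measure lebesgue (convex hull {b,c,d})"
    unfolding measure_triangle using pos by (simp flip: add_divide_distrib)
  show ?thesis
    unfolding tri_chain_def
  proof (intro conjI allI impI)
    show "\<forall>T\<in>#add_mset (convex hull {a,b,d}) (add_mset (convex hull {b,c,d}) N).
        2 simplex T \<and> vertices_of T \<subseteq> S \<and> T \<inter> S \<subseteq> vertices_of T"
      using M V simp abcd empty unfolding tri_chain_def by simp
    have "convex hull S \<subseteq> (convex hull {a,b,c} \<union> convex hull {a,c,d}) \<union> \<Union>(set_mset N)"
      using M unfolding tri_chain_def by auto
    then show "convex hull S \<subseteq> \<Union>(set_mset (add_mset (convex hull {a,b,d}) (add_mset (convex hull {b,c,d}) N)))"
      unfolding cover by auto
    show "(\<Sum>T\<in>#add_mset (convex hull {a,b,d}) (add_mset (convex hull {b,c,d}) N). edge_sign x y T) \<le> 0"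
      if "s \<in> S \<and> orient x y s < 0" for x y s
    proof -
      have "(\<Sum>T\<in>#add_mset (convex hull {a,b,c}) (add_mset (convex hull {a,c,d}) N). edge_sign x y T) \<le> 0"
        using M that unfolding tri_chain_def by blast
      then show ?thesis using edge_sign_flip[OF pos, of x y] by simp
    qed
    show "(\<Sum>T\<in>#add_mset (convex hull {a,b,d}) (add_mset (convex hull {b,c,d}) N). measure lebesgue T) =
        measure lebesgue (convex hull S)"
      using M area unfolding tri_chain_def by simp
  qed
qed

text \<open>Any two members on opposite sides of a common edge are tested, since in a multiset a
  neighbour need not be unique. Relabelling by a half turn also tests the other circle.\<close>

definition locally_delaunay :: "(real^2) set multiset \<Rightarrow> bool" where
  "locally_delaunay M \<longleftrightarrow> (\<forall>a b c d. orient a b c > 0 \<and> orient a c d > 0 \<and>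
     convex hull {a,b,c} \<in># M \<and> convex hull {a,c,d} \<in># M \<longrightarrow> circle_power (convex hull {a,b,c}) d \<le> 0)"

text \<open>The sum of the radii drops strictly and so measures progress, whereas monotonicity of
  \<open>\<phi>\<close> gives only a weak inequality.\<close>

lemma flip_exists:
  assumes M: "tri_chain S M" and nl: "\<not> locally_delaunay M"
    and mono: "mono_on {0<..} \<phi>"
  obtains M' where "tri_chain S M'" "size M' = size M"
    "(\<Sum>T\<in>#M'. circumradius T) < (\<Sum>T\<in>#M. circumradius T)"
    "(\<Sum>T\<in>#M'. \<phi> (circumradius T)) \<le> (\<Sum>T\<in>#M. (\<phi> (circumradius T) :: real))"
proof -
  obtain a b c d where pos: "orient a b c > 0" "orient a c d > 0"
    and inM: "convex hull {a,b,c} \<in># M" "convex hull {a,c,d} \<in># M"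
    and pow: "circle_power (convex hull {a,b,c}) d > 0"
    using nl unfolding locally_delaunay_def by (auto simp: not_le)
  note ill = illegal_edge[OF pos pow]
  \<comment> \<open>\<open>b\<close> and \<open>d\<close> are on opposite sides of
    \<open>ac\<close>, so the two triangles differ and can be removed from \<open>M\<close>
    together.\<close>
  have "orient a c b < 0" using pos by (simp add: orient_def algebra_simps)
  then have "d \<notin> {a,b,c}" using pos by auto
  then have "{a,b,c} \<noteq> {a,c,d}" by blast
  moreover have "vertices_of (convex hull {a,b,c}) = {a,b,c}" "vertices_of (convex hull {a,c,d}) = {a,c,d}"
    using pos triangle_simplex(2)[of a b c] triangle_simplex(2)[of a c d] by linarith+
  ultimately have "convex hull {a,b,c} \<noteq> convex hull {a,c,d}" by metis
  then obtain N where N: "M = add_mset (convex hull {a,b,c}) (add_mset (convex hull {a,c,d}) N)"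
    using inM by (metis insert_noteq_member multi_member_split)
  let ?M = "add_mset (convex hull {a,b,d}) (add_mset (convex hull {b,c,d}) N)"
  have "0 < circumradius (convex hull {a,b,d})" "0 < circumradius (convex hull {b,c,d})"
    using circumradius_pos triangle_simplex(1) ill(1,2) by (metis less_numeral_extra(3))+
  then have le: "\<phi> (circumradius (convex hull {x,y,z})) \<le> \<phi> R"
    if "circumradius (convex hull {x,y,z}) < R" "(x,y,z) = (a,b,d) \<or> (x,y,z) = (b,c,d)" for x y z R
    using that mono by (auto simp: mono_on_def)
  show thesis
  proof (rule that[of ?M])
    show "tri_chain S ?M" using tri_chain_flip M pos ill(1,2) unfolding N by blast
    show "size ?M = size M" by (simp add: N)
    show "(\<Sum>T\<in>#?M. circumradius T) < (\<Sum>T\<in>#M. circumradius T)"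
      using ill(3) by (auto simp: N)
    show "(\<Sum>T\<in>#?M. \<phi> (circumradius T)) \<le> (\<Sum>T\<in>#M. \<phi> (circumradius T))"
      using ill(3) by (auto simp: N dest!: le)
  qed
qed

text \<open>Flips keep the size, and all vertices stay in the finite set \<open>S\<close>, so only
  finitely many multisets compete. The minimum is taken among those that already satisfy the bound
  on \<open>\<phi>\<close>; a flip stays in this class.\<close>

lemma ex_locally_delaunay:
  assumes S: "finite S" and M0: "tri_chain S M0" and mono: "mono_on {0<..} \<phi>"
  obtains M where "tri_chain S M" "locally_delaunay M"
    "(\<Sum>T\<in>#M. \<phi> (circumradius T)) \<le> (\<Sum>T\<in>#M0. (\<phi> (circumradius T) :: real))"
proof -
  define X where "X = {M. tri_chain S M \<and> size M = size M0 \<and>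
     (\<Sum>T\<in>#M. \<phi> (circumradius T)) \<le> (\<Sum>T\<in>#M0. \<phi> (circumradius T))}"
  let ?A = "(\<lambda>C. convex hull C) ` Pow S"
  have "X \<subseteq> mset ` {xs. set xs \<subseteq> ?A \<and> length xs = size M0}"
  proof
    fix M assume M: "M \<in> X"
    obtain xs where xs: "M = mset xs" using ex_mset by metis
    have "T \<in> ?A" if "T \<in># M" for T
    proof -
      have "2 simplex T" "vertices_of T \<subseteq> S" using M that unfolding X_def tri_chain_def by auto
      then show ?thesis using simplex_2_obtain by (metis Pow_iff imageI)
    qed
    then show "M \<in> mset ` {xs. set xs \<subseteq> ?A \<and> length xs = size M0}"
      using M xs unfolding X_def by (intro image_eqI[of _ _ xs]) auto
  qed
  moreover have "finite {xs. set xs \<subseteq> ?A \<and> length xs = size M0}"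
    using S by (intro finite_lists_length_eq) auto
  ultimately have fin: "finite X" by (meson finite_imageI finite_subset)
  have "M0 \<in> X" using M0 by (simp add: X_def)
  then obtain M where M: "is_arg_min (\<lambda>M. \<Sum>T\<in>#M. circumradius T) (\<lambda>M. M \<in> X) M"
    using ex_is_arg_min_if_finite[OF fin, of "\<lambda>M. \<Sum>T\<in>#M. circumradius T"] by auto
  then have MX: "M \<in> X" by (simp add: is_arg_min_def)
  have "locally_delaunay M"
  proof (rule ccontr)
    assume "\<not> locally_delaunay M"
    then obtain M' where "tri_chain S M'" "size M' = size M"
      and less: "(\<Sum>T\<in>#M'. circumradius T) < (\<Sum>T\<in>#M. circumradius T)"
      and "(\<Sum>T\<in>#M'. \<phi> (circumradius T)) \<le> (\<Sum>T\<in>#M. \<phi> (circumradius T))"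
      using flip_exists[of S M \<phi>] MX mono unfolding X_def by blast
    then have "M' \<in> X" using MX by (auto simp: X_def)
    then show False using M less by (auto simp: is_arg_min_def)
  qed
  then show thesis using that MX unfolding X_def by blast
qed

subsection \<open>From local to global\<close>

lemma general_position_circle:
  assumes gp: "general_position S" and T: "2 simplex T" "vertices_of T \<subseteq> S"
    and v: "v \<in> S" "circle_power T v = 0"
  shows "v \<in> vertices_of T"
proof (rule ccontr)
  assume nv: "v \<notin> vertices_of T"
  obtain a b c where abc: "orient a b c > 0" "vertices_of T = {a,b,c}"
    using simplex_oriented[OF T(1)] by metis
  have "card (insert v {a,b,c}) = 4"
    using nv abc(2) orient_pos_distinct[OF abc(1)] by simp
  moreover have "insert v {a,b,c} \<subseteq> sphere (circumcenter T) (circumradius T)"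
    using circle_power_vertex[OF T(1)] v(2) unfolding abc(2)[symmetric] circle_power_zero_iff[OF T(1)] by blast
  moreover have "insert v {a,b,c} \<subseteq> S" using T v abc by auto
  ultimately show False
    using gp circumradius_pos[OF T(1)] unfolding general_position_def cocircular_def by blast
qed

text \<open>The signed count of \<open>ac\<close> is at most zero and \<open>T\<close> contributes
  \<open>1\<close>, so it has to be cancelled from the other side.\<close>

lemma opposite_triangle:
  assumes M: "tri_chain S M" and T: "T \<in># M" "left_edge a c T" and s: "s \<in> S" "orient a c s < 0"
  obtains T' where "T' \<in># M" "left_edge c a T'"
proof -
  have "\<exists>T'. T' \<in># M \<and> left_edge c a T'"
  proof (rule ccontr)
    assume "\<nexists>T'. T' \<in># M \<and> left_edge c a T'"
    then have nn: "edge_sign a c T' = of_bool (left_edge a c T')" if "T' \<in># M" for T'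
      using that by (simp add: edge_sign_def)
    obtain N where N: "M = add_mset T N" using T(1) by (metis multi_member_split)
    have "image_mset (edge_sign a c) M = image_mset (\<lambda>T. of_bool (left_edge a c T)) M"
      by (rule image_mset_cong) (rule nn)
    then have "(\<Sum>T\<in>#M. edge_sign a c T) = 1 + (\<Sum>T\<in>#N. of_bool (left_edge a c T))"
      using T(2) by (simp add: N)
    moreover have "(\<Sum>T\<in>#N. of_bool (left_edge a c T)) \<ge> (0::int)"
      by (induction N) simp_all
    moreover have "(\<Sum>T\<in>#M. edge_sign a c T) \<le> 0"
      using M s unfolding tri_chain_def by blast
    ultimately show False by linarith
  qed
  then show thesis using that by blast
qed

text \<open>Edge cancellation supplies a neighbour across \<open>ac\<close>. Its apex
  \<open>d\<close> is not inside the circle by the local condition and not on it by general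
  position; this makes the increase of the power strict.\<close>

lemma locally_delaunay_step:
  assumes gp: "general_position S" and M: "tri_chain S M" and loc: "locally_delaunay M"
    and b: "orient a c b > 0" "convex hull {a,c,b} \<in># M" and s: "s \<in> S" "orient a c s < 0"
  shows "\<exists>T'. T' \<in># M \<and> circle_power (convex hull {a,c,b}) s < circle_power T' s"
proof -
  let ?T = "convex hull {a,c,b}"
  have "left_edge a c ?T" using b unfolding left_edge_def by blast
  from opposite_triangle[OF M b(2) this s] obtain d
    where d: "orient c a d > 0" "convex hull {c,a,d} \<in># M"
    unfolding left_edge_def by metis
  let ?T' = "convex hull {c,a,d}"
  have o: "orient c b a > 0" "orient a c d < 0"
    using b d by (simp_all add: orient_def algebra_simps)
  have h: "{c,b,a} = {a,c,b}" by auto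
  have V: "2 simplex ?T" "vertices_of ?T = {a,c,b}" "2 simplex ?T'" "vertices_of ?T' = {c,a,d}"
    using triangle_simplex b d by auto
  have "d \<notin> {a,c,b}" using o(2) b by auto
  moreover have "d \<in> S" "vertices_of ?T \<subseteq> S" using M d b V unfolding tri_chain_def by auto
  ultimately have "circle_power ?T d \<noteq> 0"
    using general_position_circle[OF gp V(1)] V(2) by auto
  moreover have "circle_power ?T d \<le> 0"
    using loc o(1) d b(2) unfolding locally_delaunay_def h[symmetric] by blast
  ultimately have "circle_power ?T s < circle_power ?T' s"
    using circle_power_increases[of ?T a c ?T' d s] V o(2) s(2) by simp
  then show ?thesis using d by blast
qed

lemma locally_delaunay_imp_delaunay:
  assumes gp: "general_position S" and M: "tri_chain S M" and loc: "locally_delaunay M"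
  shows "set_mset M \<subseteq> delaunay S"
proof
  fix T0 assume T0: "T0 \<in># M"
  have "circle_power T0 s \<le> 0" if s: "s \<in> S" for s
  proof (rule ccontr)
    assume T0s: "\<not> circle_power T0 s \<le> 0"
    \<comment> \<open>\<open>T\<close> maximizes the power of \<open>s\<close>; hence
      \<open>s\<close> is beyond none of its edges and must lie in \<open>T\<close>.\<close>
    define T where "T = arg_min_on (\<lambda>T. - circle_power T s) (set_mset M)"
    have T: "T \<in># M"
      unfolding T_def using T0 by (intro arg_min_if_finite) auto
    have max: "circle_power T' s \<le> circle_power T s" if "T' \<in># M" for T'
    proof -
      have "set_mset M \<noteq> {}" using T0 by auto
      from arg_min_least[OF finite_set_mset this that, of "\<lambda>T. - circle_power T s"]
      show ?thesis unfolding T_def by simp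
    qed
    have "circle_power T s > 0" using max[OF T0] T0s by simp
    obtain a b c where abc: "orient a b c > 0" "T = convex hull {a,b,c}" "vertices_of T = {a,b,c}"
      using simplex_oriented M T unfolding tri_chain_def by metis
    have rot: "orient b c a > 0" "orient c a b > 0" "{b,c,a} = {a,b,c}" "{c,a,b} = {a,b,c}"
      using abc(1) by (auto simp: orient_def algebra_simps)
    have "\<not> orient x y s < 0" if xyz: "orient x y z > 0" "{x,y,z} = {a,b,c}" for x y z
    proof
      assume "orient x y s < 0"
      then obtain T' where "T' \<in># M" "circle_power T s < circle_power T' s"
        using locally_delaunay_step[OF gp M loc xyz(1) _ s] T abc(2) xyz(2) by metis
      then show False using max by fastforce
    qed
    then have "s \<in> T"
      using abc rot by (simp add: mem_triangle not_less)
    then have "s \<in> vertices_of T" using M T s unfolding tri_chain_def by auto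
    then have "circle_power T s = 0" using circle_power_vertex M T unfolding tri_chain_def by auto
    then show False using \<open>circle_power T s > 0\<close> by simp
  qed
  moreover have "2 simplex T0" "vertices_of T0 \<subseteq> S" using T0 M unfolding tri_chain_def by auto
  ultimately show "T0 \<in> delaunay S"
    using circle_power_pos_iff[of T0] unfolding delaunay_def by (simp add: disjoint_iff) (meson not_less)
qed

section \<open>Uniqueness of a multiset of Delaunay triangles\<close>

lemma circle_power_le_on_triangle:
  assumes T: "2 simplex T" "x \<in> T" and le: "\<And>v. v \<in> vertices_of T \<Longrightarrow> circle_power D v \<le> 0"
  shows "circle_power D x \<le> circle_power T x"
proof -
  obtain a b c where abc: "orient a b c > 0" "T = convex hull {a,b,c}" "vertices_of T = {a,b,c}"
    using simplex_oriented T(1) by metis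
  obtain u v w where x: "x = u *\<^sub>R a + v *\<^sub>R b + w *\<^sub>R c" "0 \<le> u" "0 \<le> v" "0 \<le> w" "u + v + w = 1"
    using T(2) unfolding abc(2) convex_hull_3 by auto
  have "circle_power D x - circle_power T x = u * circle_power D a + v * circle_power D b + w * circle_power D c"
    unfolding x(1) circle_power_diff_comb[OF x(5)] using circle_power_vertex[OF T(1)] abc(3) by simp
  also have "\<dots> \<le> 0"
    using x le abc(3) by (intro add_nonpos_nonpos mult_nonneg_nonpos) auto
  finally show ?thesis by simp
qed

text \<open>The two powers of \<open>y\<close> bound each other, hence agree. Since \<open>y\<close>
  has positive weights in \<open>T\<close>, equality puts every vertex of \<open>T\<close> on the
  circumcircle of \<open>D\<close>, where general position admits only vertices of
  \<open>D\<close>.\<close>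

lemma delaunay_interiors_meet:
  assumes gp: "general_position S" and D: "D \<in> delaunay S" and T: "T \<in> delaunay S"
    and y: "y \<in> interior D" "y \<in> interior T"
  shows "D = T"
proof -
  have DT: "2 simplex D" "vertices_of D \<subseteq> S" "2 simplex T" "vertices_of T \<subseteq> S"
    using D T by (auto simp: delaunay_def)
  have le: "circle_power D v \<le> 0" "circle_power T v \<le> 0" if "v \<in> S" for v
    using that D T DT circle_power_pos_iff[of D v] circle_power_pos_iff[of T v] by (force simp: delaunay_def)+
  obtain a b c where abc: "orient a b c > 0" "T = convex hull {a,b,c}" "vertices_of T = {a,b,c}"
    using simplex_oriented DT(3) by metis
  have "\<not> collinear {a,b,c}" using abc(1) orient_nonzero_noncollinear by simp
  then obtain u v w where x: "y = u *\<^sub>R a + v *\<^sub>R b + w *\<^sub>R c" "0 < u" "0 < v" "0 < w" "u + v + w = 1"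
    using y(2) unfolding abc(2) by (subst (asm) interior_convex_hull_3_minimal) auto
  have "circle_power D y - circle_power T y = u * circle_power D a + v * circle_power D b + w * circle_power D c"
    unfolding x(1) circle_power_diff_comb[OF x(5)] using circle_power_vertex[OF DT(3)] abc(3) by simp
  moreover have "circle_power T y \<le> circle_power D y"
    using circle_power_le_on_triangle[OF DT(1), of y T] y(1) interior_subset le DT by blast
  moreover have "u * circle_power D a \<le> 0" "v * circle_power D b \<le> 0" "w * circle_power D c \<le> 0"
    using x le DT abc(3) by (auto intro!: mult_nonneg_nonpos)
  ultimately have "u * circle_power D a = 0" "v * circle_power D b = 0" "w * circle_power D c = 0" by linarith+
  then have "circle_power D z = 0" if "z \<in> vertices_of T" for z
    using that x abc(3) by auto
  then have sub: "vertices_of T \<subseteq> vertices_of D"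
    using general_position_circle[OF gp DT(1,2)] DT(4) by blast
  obtain a' b' c' where abc': "orient a' b' c' > 0" "D = convex hull {a',b',c'}" "vertices_of D = {a',b',c'}"
    using simplex_oriented DT(1) by metis
  have "card (vertices_of T) = 3" "card (vertices_of D) = 3"
    using abc(3) abc'(3) orient_pos_distinct[OF abc(1)] orient_pos_distinct[OF abc'(1)] by auto
  then have "vertices_of T = vertices_of D"
    using sub abc'(3) by (intro card_subset_eq) auto
  then show ?thesis using abc abc' by metis
qed

lemma triangle_interior:
  assumes "2 simplex (T :: (real^2) set)"
  shows "interior T \<noteq> {}" "convex T" "compact T" "T \<in> lmeasurable" "measure lebesgue T > 0"
proof -
  obtain a b c where abc: "orient a b c > 0" "T = convex hull {a,b,c}"
    using simplex_oriented assms by metis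
  show "convex T" "compact T" unfolding abc(2) by (simp_all add: finite_imp_compact_convex_hull)
  then show "T \<in> lmeasurable" by (simp add: lmeasurable_compact)
  show pos: "measure lebesgue T > 0" using abc by (simp add: measure_triangle)
  then show "interior T \<noteq> {}"
    using negligible_convex_interior[OF \<open>convex T\<close>] negligible_imp_measure0 by fastforce
qed

lemma sum_mset_eq_sum_count:
  assumes "finite A" "set_mset M \<subseteq> A"
  shows "(\<Sum>x\<in>#M. f x) = (\<Sum>x\<in>A. real (count M x) * f x)"
  using assms(2)
proof (induction M)
  case (add y M)
  have "(\<Sum>x\<in>A. real (count (add_mset y M) x) * f x) =
      (\<Sum>x\<in>A. (if x = y then f x else 0) + real (count M x) * f x)"
    by (intro sum.cong) (auto simp: algebra_simps)
  also have "\<dots> = f y + (\<Sum>x\<in>A. real (count M x) * f x)"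
    using assms(1) add.prems by (simp add: sum.distrib)
  finally show ?case using add by simp
qed simp

lemma delaunay_chain_unique:
  assumes S: "finite S" and gp: "general_position S" and M: "tri_chain S M" and sub: "set_mset M \<subseteq> delaunay S"
  shows "M = mset_set (delaunay S)"
proof -
  have tri: "2 simplex T" if "T \<in># M" for T using that M by (simp add: tri_chain_def)
  have "D \<in># M" if D: "D \<in> delaunay S" for D
  proof -
    have D2: "2 simplex D" "vertices_of D \<subseteq> S" using D by (auto simp: delaunay_def)
    obtain x where x: "x \<in> interior D" using triangle_interior(1)[OF D2(1)] by blast
    have "D \<subseteq> convex hull S"
      using simplex_oriented[OF D2(1)] D2(2) by (metis hull_mono)
    then obtain T where T: "T \<in># M" "x \<in> T"
      using x interior_subset M unfolding tri_chain_def by blast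
    \<comment> \<open>\<open>x\<close> may be on the boundary of the covering triangle
      \<open>T\<close>, but some point near it is interior to both \<open>D\<close> and
      \<open>T\<close>.\<close>
    have "x \<in> closure (interior T)"
      using convex_closure_interior[OF triangle_interior(2,1)] tri[OF T(1)] T(2) closure_subset by blast
    then obtain y where "y \<in> interior D" "y \<in> interior T"
      using x by (metis closure_iff_nhds_not_empty disjoint_iff interior_subset open_interior order_refl)
    then show ?thesis using delaunay_interiors_meet[OF gp D] T(1) sub by blast
  qed
  then have set: "set_mset M = delaunay S" using sub by blast
  have pos: "measure lebesgue T > 0" if "T \<in> delaunay S" for T
    using that triangle_interior(5) by (auto simp: delaunay_def)
  \<comment> \<open>With multiplicities the areas sum to the area of the hull, which is at most
    their sum without multiplicities. As the areas are positive, no multiplicity exceeds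
    one.\<close>
  have "(\<Sum>T\<in>delaunay S. real (count M T) * measure lebesgue T) = (\<Sum>T\<in>#M. measure lebesgue T)"
    using sum_mset_eq_sum_count[of "delaunay S" M] finite_delaunay[OF S] set by auto
  also have "\<dots> = measure lebesgue (convex hull S)" using M by (simp add: tri_chain_def)
  also have "\<dots> \<le> measure lebesgue (\<Union>(delaunay S))"
  proof (rule measure_mono_fmeasurable)
    show "convex hull S \<subseteq> \<Union>(delaunay S)" using M set by (simp add: tri_chain_def)
    show "convex hull S \<in> sets lebesgue"
      using S by (intro fmeasurableD lmeasurable_compact finite_imp_compact_convex_hull)
    show "\<Union>(delaunay S) \<in> lmeasurable"
      using tri triangle_interior(3) finite_delaunay[OF S] set
      by (intro lmeasurable_compact compact_Union) auto
  qed
  also have "\<dots> \<le> (\<Sum>T\<in>delaunay S. measure lebesgue T)"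
    using triangle_interior(4) finite_delaunay[OF S]
    by (intro measure_Union_le) (auto simp: delaunay_def)
  finally have le: "(\<Sum>T\<in>delaunay S. real (count M T) * measure lebesgue T) \<le> (\<Sum>T\<in>delaunay S. measure lebesgue T)" .
  have "count M T = 1" if T: "T \<in> delaunay S" for T
  proof (rule ccontr)
    assume "count M T \<noteq> 1"
    then have "count M T > 1" using T set by (metis count_greater_zero_iff less_one nat_neq_iff)
    moreover have "count M T' \<ge> 1" if "T' \<in> delaunay S" for T' using that set by (simp add: Suc_le_eq)
    ultimately have "(\<Sum>T\<in>delaunay S. measure lebesgue T) < (\<Sum>T\<in>delaunay S. real (count M T) * measure lebesgue T)"
      using T pos by (intro sum_strict_mono_ex1 finite_delaunay[OF S]) (auto intro!: bexI[of _ T] simp: order_less_imp_le)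
    then show False using le by simp
  qed
  then show ?thesis
    using set finite_delaunay[OF S] by (intro multiset_eqI) (metis count_mset_set(1) count_mset_set(3) not_in_iff)
qed

subsection \<open>Triangulations as triangle multisets\<close>

lemma triangulation_ofD:
  assumes "triangulation_of S t"
  shows "finite t" "\<Union>t = convex hull S" "(\<Union>T\<in>t. vertices_of T) = S"
    "T \<in> t \<Longrightarrow> 2 simplex T" "T \<in> t \<Longrightarrow> T' \<in> t \<Longrightarrow> T \<inter> T' face_of T"
  using assms unfolding triangulation_of_def triangulation_def by blast+

text \<open>\<open>T \<inter> T'\<close> is a face of both triangles: an extreme point of
  \<open>T\<close> in it is extreme in the face, hence extreme in \<open>T'\<close>.\<close>

lemma triangulation_vertex:
  assumes t: "triangulation_of S t" "T \<in> t" "T' \<in> t" and v: "v \<in> vertices_of T" "v \<in> T'"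
  shows "v \<in> vertices_of T'"
proof -
  have "v \<in> T" using v(1) by (auto simp: vertices_of_def extreme_point_of_def)
  moreover have "T \<inter> T' face_of T" "T \<inter> T' face_of T'"
    using triangulation_ofD(5)[OF t] triangulation_ofD(5)[OF t(1,3,2)] by (simp_all add: Int_commute)
  ultimately show ?thesis
    using v extreme_point_of_face unfolding vertices_of_def by blast
qed

text \<open>A face that meets the relative interior is the whole set, so each triangle contains the
  other.\<close>

lemma triangulation_interiors_meet:
  assumes t: "triangulation_of S t" "T \<in> t" "T' \<in> t" and y: "y \<in> interior T" "y \<in> interior T'"
  shows "T = T'"
proof -
  have "A \<subseteq> B" if "A \<in> t" "B \<in> t" "y \<in> interior A" "y \<in> interior B" for A B
  proof -
    have "y \<in> rel_interior A" using that interior_subset_rel_interior by blast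
    moreover have "A \<inter> B face_of A" using triangulation_ofD(5)[OF t(1)] that by blast
    moreover have "y \<in> A \<inter> B" using that interior_subset by blast
    ultimately show ?thesis using subset_of_face_of[of "A \<inter> B" A A] by blast
  qed
  then show ?thesis using t y by blast
qed

section \<open>Triangles on the two sides of an edge\<close>

lemma interior_triangleI:
  assumes "orient a b c > 0" "orient a b x > 0" "orient b c x > 0" "orient c a x > 0"
  shows "x \<in> interior (convex hull {a,b,c})"
proof -
  define U where "U = {x. orient a b x > 0} \<inter> {x. orient b c x > 0} \<inter> {x. orient c a x > 0}"
  have "open U" unfolding U_def orient_def
    by (intro open_Int open_Collect_less continuous_intros)
  moreover have "U \<subseteq> convex hull {a,b,c}"
    using assms(1) by (auto simp: U_def mem_triangle)
  ultimately show ?thesis using assms interior_maximal[of U] by (auto simp: U_def)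
qed

text \<open>Small displacements preserve open conditions; this is how points just beside the
  midpoint of an edge are found.\<close>

lemma eventually_towards:
  assumes "open U" "(m :: real^2) \<in> U"
  shows "\<forall>\<^sub>F e in at_right (0::real). (1 - e) *\<^sub>R m + e *\<^sub>R y \<in> U"
proof (rule topological_tendstoD[OF _ assms])
  have "((\<lambda>e. (1 - e) *\<^sub>R m + e *\<^sub>R y) \<longlongrightarrow> (1 - 0) *\<^sub>R m + 0 *\<^sub>R y) (at_right (0::real))"
    by (intro tendsto_intros)
  then show "((\<lambda>e. (1 - e) *\<^sub>R m + e *\<^sub>R y) \<longlongrightarrow> m) (at_right (0::real))" by simp
qed

lemma eventually_unit_at_right: "\<forall>\<^sub>F e in at_right (0::real). 0 < e \<and> e < 1"
  by (rule eventually_at_rightI[of 0 1]) auto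

lemma orient_towards:
  "orient p q ((1 - e) *\<^sub>R m + e *\<^sub>R y) = (1 - e) * orient p q m + e * orient p q y"
  using orient_comb[of "1 - e" e 0 p q m y 0] by simp

lemma orient_midpoint:
  "orient p q (midpoint a c) = (orient p q a + orient p q c) / 2"
  by (simp add: midpoint_def orient_def field_simps)

text \<open>Some point just to the left of the midpoint of \<open>ac\<close> is interior to both
  triangles.\<close>

lemma left_edge_unique:
  assumes t: "triangulation_of S t" "T \<in> t" "T' \<in> t" and l: "left_edge a c T" "left_edge a c T'"
  shows "T = T'"
proof -
  obtain b where b: "orient a c b > 0" "T = convex hull {a,c,b}"
    using l unfolding left_edge_def by auto
  obtain b' where b': "orient a c b' > 0" "T' = convex hull {a,c,b'}"
    using l unfolding left_edge_def by auto
  have o: "orient c x a = orient a c x" "orient x a c = orient a c x" for x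
    by (simp_all add: orient_def algebra_simps)
  define m where "m = midpoint a c"
  have om: "orient a c m = 0" "orient c x m = orient a c x / 2" "orient x a m = orient a c x / 2" for x
    by (simp_all add: m_def orient_midpoint o)
  define U where "U = {x. orient c b' x > 0} \<inter> {x. orient b' a x > 0}"
  have "open U" unfolding U_def orient_def
    by (intro open_Int open_Collect_less continuous_intros)
  moreover have "m \<in> U" using b' by (simp add: U_def om)
  ultimately have "\<forall>\<^sub>F e in at_right (0::real). (1 - e) *\<^sub>R m + e *\<^sub>R b \<in> U \<and> 0 < e \<and> e < 1"
    by (intro eventually_conj eventually_towards eventually_unit_at_right)
  then obtain e where e: "(1 - e) *\<^sub>R m + e *\<^sub>R b \<in> U" "0 < e" "e < 1"
    using eventually_happens'[OF trivial_limit_at_right_real] by blast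
  define y where "y = (1 - e) *\<^sub>R m + e *\<^sub>R b"
  have "orient a c y > 0" "orient c b y > 0" "orient b a y > 0"
    using b e unfolding y_def orient_towards om by simp_all
  moreover have "orient c b' y > 0" "orient b' a y > 0"
    using e(1) unfolding U_def y_def by auto
  ultimately have "y \<in> interior T" "y \<in> interior T'"
    unfolding b(2) b'(2) using interior_triangleI[OF b(1)] interior_triangleI[OF b'(1)] by blast+
  then show ?thesis using triangulation_interiors_meet[OF t] by blast
qed

text \<open>Moving from the midpoint of \<open>ac\<close> slightly towards \<open>s\<close> stays in
  the hull. A triangle covering the new point also contains the midpoint, so the face property gives
  it the edge \<open>ac\<close>.\<close>

lemma left_edge_opposite:
  assumes t: "triangulation_of S t" "T \<in> t" and l: "left_edge a c T"
    and s: "s \<in> S" "orient a c s < 0"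
  obtains T' where "T' \<in> t" "left_edge c a T'"
proof -
  obtain b where b: "orient a c b > 0" "T = convex hull {a,c,b}"
    using l unfolding left_edge_def by auto
  have VT: "vertices_of T = {a,c,b}" using triangle_simplex b by auto
  define m where "m = midpoint a c"
  have om: "orient a c m = 0" by (simp add: m_def orient_midpoint)
  have fin: "finite t" using triangulation_ofD(1)[OF t(1)] .
  \<comment> \<open>The finitely many triangles that miss \<open>m\<close> have a closed union, so
    points close to \<open>m\<close> lie only in triangles containing \<open>m\<close>.\<close>
  define B where "B = \<Union>{T \<in> t. m \<notin> T}"
  have "closed B" unfolding B_def
    using fin triangulation_ofD(4)[OF t(1)] triangle_interior(3) by (intro closed_Union) (auto intro: compact_imp_closed)
  then have "open (- B)" "m \<in> - B" unfolding B_def by auto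
  then have "\<forall>\<^sub>F e in at_right (0::real). (1 - e) *\<^sub>R m + e *\<^sub>R s \<in> - B \<and> 0 < e \<and> e < 1"
    by (intro eventually_conj eventually_towards eventually_unit_at_right)
  then obtain e where e: "(1 - e) *\<^sub>R m + e *\<^sub>R s \<in> - B" "0 < e" "e < 1"
    using eventually_happens'[OF trivial_limit_at_right_real] by blast
  define y where "y = (1 - e) *\<^sub>R m + e *\<^sub>R s"
  have ac: "a \<noteq> c" "a \<in> T" "c \<in> T" unfolding b(2) using orient_pos_distinct[OF b(1)] by (auto intro: hull_inc)
  have mseg: "m \<in> open_segment a c" using ac(1) by (simp add: m_def)
  have mT: "m \<in> T"
    using ac(2,3) mseg triangle_interior(2) triangulation_ofD(4)[OF t] 
    by (meson convex_contains_open_segment subsetD)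
  have "m \<in> convex hull S" using mT triangulation_ofD(2)[OF t(1)] t(2) by blast
  moreover have "s \<in> convex hull S" using s by (simp add: hull_inc)
  ultimately have "y \<in> convex hull S"
    unfolding y_def using e by (intro convexD) auto
  then obtain T' where T': "T' \<in> t" "y \<in> T'" using triangulation_ofD(2)[OF t(1)] by blast
  then have "m \<in> T'" using e(1) unfolding B_def y_def by auto
  then have "m \<in> T \<inter> T'" using mT by blast
  \<comment> \<open>The face \<open>T \<inter> T'\<close> of \<open>T\<close> contains an inner
    point of the segment \<open>ac\<close>, hence both its endpoints.\<close>
  then have "a \<in> T'" "c \<in> T'"
    using face_ofD[OF triangulation_ofD(5)[OF t T'(1)] mseg] ac by auto
  then have acV: "a \<in> vertices_of T'" "c \<in> vertices_of T'"
    using triangulation_vertex[OF t T'(1)] VT by auto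
  obtain p q r where pqr: "orient p q r > 0" "T' = convex hull {p,q,r}" "vertices_of T' = {p,q,r}"
    using simplex_oriented[OF triangulation_ofD(4)[OF t(1) T'(1)]] by metis
  have "a \<in> {p,q,r}" "c \<in> {p,q,r}" using acV pqr(3) by auto
  then obtain d where d: "{p,q,r} = {a,c,d}" using ac(1) by (elim insertE emptyE) blast+
  have "orient p q r \<noteq> 0" using pqr(1) by simp
  from noncollinear_det[OF orient_nonzero_noncollinear[OF this, unfolded d]]
  have "orient a c d \<noteq> 0" by (simp add: orient_def)
  \<comment> \<open>Otherwise \<open>T'\<close> would lie to the left of \<open>ac\<close>, but
    \<open>y\<close> is strictly to the right.\<close>
  moreover have "\<not> orient a c d > 0"
  proof
    assume "orient a c d > 0"
    then have "orient a c y \<ge> 0" using T'(2) unfolding pqr(2) d by (simp add: mem_triangle)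
    moreover have "orient a c y < 0"
      unfolding y_def orient_towards om using e s by (simp add: mult_pos_neg)
    ultimately show False by simp
  qed
  ultimately have "orient c a d > 0" using orient_swap[of c a d] by simp
  moreover have "T' = convex hull {c,a,d}" unfolding pqr(2) d by (simp add: insert_commute)
  ultimately have "left_edge c a T'" unfolding left_edge_def by blast
  then show thesis using that T'(1) by blast
qed

text \<open>At most one triangle lies to the left of \<open>ac\<close>; if there is one, the site
  \<open>s\<close> on the right ensures a triangle on the right as well.\<close>

lemma triangulation_edge_sign:
  assumes t: "triangulation_of S t" and s: "s \<in> S" "orient a c s < 0"
  shows "(\<Sum>T\<in>t. edge_sign a c T) \<le> 0"
proof (cases "\<exists>T\<in>t. left_edge a c T")
  case False
  then show ?thesis by (intro sum_nonpos) (auto simp: edge_sign_def)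
next
  case True
  then obtain T where T: "T \<in> t" "left_edge a c T" by blast
  obtain T' where T': "T' \<in> t" "left_edge c a T'"
    using left_edge_opposite[OF t T s] by blast
  have fin: "finite t" using triangulation_ofD(1)[OF t] .
  have "left_edge a c X \<longleftrightarrow> X = T" if "X \<in> t" for X
    using left_edge_unique[OF t T(1) that T(2)] T(2) by blast
  then have "(\<Sum>X\<in>t. of_bool (left_edge a c X) :: int) = (\<Sum>X\<in>t. if X = T then 1 else 0)"
    by (intro sum.cong) auto
  also have "\<dots> = 1" using fin T(1) by simp
  also have "1 = (of_bool (left_edge c a T') :: int)" using T'(2) by simp
  also have "\<dots> \<le> (\<Sum>X\<in>t. of_bool (left_edge c a X))"
    using fin T'(1) by (intro member_le_sum) auto
  finally show ?thesis by (simp add: edge_sign_def sum_subtractf)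
qed

lemma triangulation_tri_chain:
  assumes S: "finite S" and t: "triangulation_of S t"
  shows "tri_chain S (mset_set t)"
proof -
  note D = triangulation_ofD[OF t]
  have vert: "T \<inter> S \<subseteq> vertices_of T" if T: "T \<in> t" for T
  proof
    fix x assume x: "x \<in> T \<inter> S"
    then obtain T' where "T' \<in> t" "x \<in> vertices_of T'" using D(3) by blast
    then show "x \<in> vertices_of T" using triangulation_vertex[OF t _ T] x by blast
  qed
  \<comment> \<open>Overlaps are convex sets without interior points, hence null sets, so the areas
    add up.\<close>
  have "negligible (T \<inter> T')" if T: "T \<in> t" "T' \<in> t" "T \<noteq> T'" for T T'
  proof -
    have "interior (T \<inter> T') = {}" using triangulation_interiors_meet[OF t T(1,2)] T(3) by auto
    moreover have "convex (T \<inter> T')" using triangle_interior(2) D(4) T by (intro convex_Int) auto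
    ultimately show ?thesis by (simp add: negligible_convex_interior)
  qed
  then have "measure lebesgue (\<Union>t) = (\<Sum>T\<in>t. measure lebesgue T)"
    using D(1,4) triangle_interior(4) by (intro measure_negligible_finite_Union) (auto simp: pairwise_def)
  then have area: "(\<Sum>T\<in>t. measure lebesgue T) = measure lebesgue (convex hull S)"
    using D(2) by simp
  have sums: "(\<Sum>T\<in>#mset_set t. f T) = sum f t" for f :: "(real^2) set \<Rightarrow> 'a::comm_monoid_add"
    by (simp add: sum_unfold_sum_mset)
  show ?thesis
    unfolding tri_chain_def sums area
  proof (intro conjI allI impI)
    show "\<forall>T\<in>#mset_set t. 2 simplex T \<and> vertices_of T \<subseteq> S \<and> T \<inter> S \<subseteq> vertices_of T"
      using D vert by auto
    show "convex hull S \<subseteq> \<Union>(set_mset (mset_set t))" using D by simp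
    show "(\<Sum>T\<in>t. edge_sign a c T) \<le> 0" if "s \<in> S \<and> orient a c s < 0" for a c s
      using triangulation_edge_sign[OF t] that by blast
  qed simp
qed

theorem theorem4:
  fixes S :: "(real^2) set" and \<phi> :: "real \<Rightarrow> real" and t :: "(real^2) set set"
  assumes "finite S"
    and "\<not> collinear S"
    and "general_position S"
    and "mono_on {0<..} \<phi>"
    and "triangulation_of S t"
  shows "(\<Sum>T\<in>delaunay S. \<phi> (circumradius T)) \<le> (\<Sum>T\<in>t. \<phi> (circumradius T))"
proof -
  obtain M where M: "tri_chain S M" "locally_delaunay M"
    "(\<Sum>T\<in>#M. \<phi> (circumradius T)) \<le> (\<Sum>T\<in>#mset_set t. \<phi> (circumradius T))"
    using ex_locally_delaunay[OF assms(1) triangulation_tri_chain[OF assms(1,5)] assms(4)] by blast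
  \<comment> \<open>\<open>M\<close> was obtained from \<open>\<phi>\<close> and \<open>t\<close>,
    but its local property already determines it.\<close>
  have "M = mset_set (delaunay S)"
    using delaunay_chain_unique locally_delaunay_imp_delaunay M(1,2) assms(1,3) by blast
  then show ?thesis using M(3) by (simp add: sum_unfold_sum_mset)
qed

end
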